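(* For every integer $k \ge 0$, $|I_k(132)|$ is equal to the number of integer partitions of $k$.
   Context: A permutation of length $n$ is a word $\pi=\pi_1\cdots\pi_n$ containing each of $1,\dots,n$ exactly once. The sum of permutations $\rho=\rho_1\cdots\rho_n$ and $\tau=\tau_1\cdots\tau_m$ is the permutation $\rho\oplus\tau=\rho_1\cdots\rho_n(n+\tau_1)\cdots(n+\tau_m)$ of length $n+m$. A permutation is decomposable if it equals $\rho\oplus\tau$ for some non-empty permutations $\rho,\tau$; a non-empty permutation that is not decomposable is indecomposable. An inversion of $\pi$ is a pair $(i,j)$ with $i<j$ and $\pi_i>\pi_j$. A permutation $\pi$ contains a permutation (pattern) $\tau=\tau_1\cdots\tau_m$ if there are indices $i_1<\dots<i_m$ such that $\pi_{i_1},\dots,\pi_{i_m}$ is order-isomorphic to $\tau_1,\dots,\tau_m$; otherwise $\pi$ avoids $\tau$. $I_k(\tau_1,\dots,\tau_r)$ denotes the (finite) set of all indecomposable permutations, of any length, with exactly $k$ inversions that avoid all of $\tau_1,\dots,\tau_r$. *)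

theory Defs
  imports "HOL-Library.Multiset"
begin

text \<open>
  Permutations are words with entries in \<open>{1..n}\<close>, as lists; list positions start at 0.
\<close>

definition is_perm :: "nat list \<Rightarrow> bool" where
  "is_perm \<pi> \<longleftrightarrow> distinct \<pi> \<and> set \<pi> = {1..length \<pi>}"

definition perm_sum :: "nat list \<Rightarrow> nat list \<Rightarrow> nat list" where
  "perm_sum \<rho> \<tau> = \<rho> @ map (\<lambda>x. length \<rho> + x) \<tau>"

definition decomposable :: "nat list \<Rightarrow> bool" where
  "decomposable \<pi> \<longleftrightarrow>
     (\<exists>\<rho> \<tau>. is_perm \<rho> \<and> is_perm \<tau> \<and> \<rho> \<noteq> [] \<and> \<tau> \<noteq> [] \<and> \<pi> = perm_sum \<rho> \<tau>)"

definition indecomposable :: "nat list \<Rightarrow> bool" where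
  "indecomposable \<pi> \<longleftrightarrow> is_perm \<pi> \<and> \<pi> \<noteq> [] \<and> \<not> decomposable \<pi>"

definition inversions :: "nat list \<Rightarrow> (nat \<times> nat) set" where
  "inversions \<pi> = {(i, j). i < j \<and> j < length \<pi> \<and> \<pi> ! i > \<pi> ! j}"

definition contains :: "nat list \<Rightarrow> nat list \<Rightarrow> bool" where
  "contains \<pi> \<tau> \<longleftrightarrow>
     (\<exists>f :: nat \<Rightarrow> nat. strict_mono_on {..<length \<tau>} f \<and> f ` {..<length \<tau>} \<subseteq> {..<length \<pi>} \<and>
        (\<forall>a < length \<tau>. \<forall>b < length \<tau>. \<pi> ! f a < \<pi> ! f b \<longleftrightarrow> \<tau> ! a < \<tau> ! b))"

definition avoids :: "nat list \<Rightarrow> nat list \<Rightarrow> bool" where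
  "avoids \<pi> \<tau> \<longleftrightarrow> \<not> contains \<pi> \<tau>"

definition indec_avoiders :: "nat \<Rightarrow> nat list set \<Rightarrow> nat list set" where
  "indec_avoiders k T =
     {\<pi>. indecomposable \<pi> \<and> card (inversions \<pi>) = k \<and> (\<forall>\<tau>\<in>T. avoids \<pi> \<tau>)}"

definition integer_partitions :: "nat \<Rightarrow> nat multiset set" where
  "integer_partitions k = {M. 0 \<notin># M \<and> \<Sum>\<^sub># M = k}"

end

theory Submission
  imports Defs
begin

text \<open>
  The bijection is given by the Lehmer code: entry \<open>i\<close> of the code of a word counts the later
  letters that are smaller than the \<open>i\<close>-th one. The code sums to the number of inversions
  (\<open>sum_list_lehmer_code\<close>), and a word without repeated letters avoids 132 iff its code is weakly
  decreasing (\<open>avoids_132_iff\<close>). So the nonzero code entries of an avoider with \<open>k\<close>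
  inversions form a partition of \<open>k\<close>, and the code itself is that partition, listed in
  decreasing order and padded with zeros.

  It remains to see that indecomposability selects exactly one amount of padding. The code of a
  sum \<open>\<rho> \<oplus> \<tau>\<close> is the concatenation of the codes of \<open>\<rho>\<close> and \<open>\<tau>\<close>, so appending zeros to
  the code of \<open>\<pi>\<close> amounts to adding an increasing permutation to \<open>\<pi>\<close>. Since a permutation is
  determined by its code (\<open>lehmer_code_inj\<close>), of two avoiders whose codes differ only in
  padding the longer one is decomposable. Conversely, enough padding turns every
  partition into the code of a permutation (\<open>lehmer_code_surj\<close>), and the shortest non-empty
  permutation obtained in this way is indecomposable: the last code entry of a non-empty summand
  \<open>\<rho>\<close> is zero, hence so are all entries contributed by \<open>\<tau>\<close>, and \<open>\<rho>\<close> alone would be a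
  shorter choice.
\<close>

section \<open>The Lehmer code\<close>

text \<open>
  The code is taken of arbitrary words over a linear order, so that inductions may pass to the
  tail of a permutation without standardising it.
\<close>

fun lehmer_code :: "'a::linorder list \<Rightarrow> nat list" where
  "lehmer_code [] = []"
| "lehmer_code (x # xs) = length (filter (\<lambda>y. y < x) xs) # lehmer_code xs"

lemma length_lehmer_code [simp]: "length (lehmer_code xs) = length xs"
  by (induction xs) auto

lemma last_lehmer_code: "xs \<noteq> [] \<Longrightarrow> last (lehmer_code xs) = 0"
  by (induction xs rule: induct_list012) auto

lemma lehmer_code_append:
  assumes "\<And>x y. x \<in> set xs \<Longrightarrow> y \<in> set ys \<Longrightarrow> x \<le> y"
  shows "lehmer_code (xs @ ys) = lehmer_code xs @ lehmer_code ys"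
  using assms
proof (induction xs)
  case (Cons x xs)
  have "filter (\<lambda>y. y < x) ys = []"
    using Cons.prems by (force simp: filter_empty_conv)
  with Cons show ?case by simp
qed simp

lemma lehmer_code_map_add: "lehmer_code (map (\<lambda>x. n + x) xs) = lehmer_code xs"
  for n :: nat
  by (induction xs) (auto simp: filter_map o_def)

lemma lehmer_code_sorted: "sorted xs \<Longrightarrow> lehmer_code xs = replicate (length xs) 0"
  by (induction xs) (auto simp: filter_empty_conv)

lemma lehmer_code_perm_sum:
  assumes "is_perm \<rho>" "is_perm \<tau>"
  shows "lehmer_code (perm_sum \<rho> \<tau>) = lehmer_code \<rho> @ lehmer_code \<tau>"
  using assms unfolding perm_sum_def is_perm_def
  by (subst lehmer_code_append) (auto simp: lehmer_code_map_add)

lemma finite_inversions: "finite (inversions xs)"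
  by (rule finite_subset[of _ "{..<length xs} \<times> {..<length xs}"]) (auto simp: inversions_def)

lemma sum_list_lehmer_code: "sum_list (lehmer_code xs) = card (inversions xs)"
proof (induction xs)
  case (Cons x xs)
  let ?A = "(\<lambda>j. (0::nat, Suc j)) ` {j. j < length xs \<and> xs ! j < x}"
  let ?B = "(\<lambda>(i, j). (Suc i, Suc j)) ` inversions xs"
  have "inversions (x # xs) = ?A \<union> ?B"
  proof (intro equalityI subsetI)
    fix p assume p: "p \<in> inversions (x # xs)"
    obtain i j where ij: "p = (i, j)" by force
    with p obtain j' where j': "j = Suc j'" by (cases j) (auto simp: inversions_def)
    show "p \<in> ?A \<union> ?B"
    proof (cases i)
      case 0
      with p ij j' show ?thesis by (auto simp: inversions_def)
    next
      case (Suc i')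
      with p ij j' have "(i', j') \<in> inversions xs" by (auto simp: inversions_def)
      then have "p \<in> ?B" using Suc ij j' by force
      then show ?thesis by blast
    qed
  qed (auto simp: inversions_def)
  moreover have "card (?A \<union> ?B) = card ?A + card ?B"
    by (intro card_Un_disjoint finite_imageI finite_inversions) auto
  moreover have "card ?A = length (filter (\<lambda>y. y < x) xs)"
    by (subst card_image) (auto simp: inj_on_def length_filter_conv_card)
  moreover have "card ?B = card (inversions xs)"
    by (rule card_image) (auto simp: inj_on_def)
  ultimately show ?case using Cons.IH by simp
qed (simp add: inversions_def)

section \<open>Words with a given code\<close>

lemma length_filter_less_distinct:
  fixes x :: "'a::linorder"
  assumes "distinct (x # xs)"
  shows "length (filter (\<lambda>y. y < x) xs) = card {y \<in> set (x # xs). y < x}"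
proof -
  have "{y \<in> set (x # xs). y < x} = set (filter (\<lambda>y. y < x) xs)"
    by auto
  then show ?thesis
    using assms by (metis distinct_card distinct_filter distinct.simps(2))
qed

text \<open>An element of a finite linearly ordered set is determined by its rank.\<close>

lemma rank_inj:
  fixes x y :: "'a::linorder"
  assumes "finite S" "x \<in> S" "y \<in> S" "card {z \<in> S. z < x} = card {z \<in> S. z < y}"
  shows "x = y"
proof -
  have less: "card {z \<in> S. z < a} < card {z \<in> S. z < b}" if "a < b" "a \<in> S" for a b
    using assms(1) that by (intro psubset_card_mono) auto
  show ?thesis
    using less[of x y] less[of y x] assms(2-4) by (metis less_irrefl linorder_neqE)
qed

lemma rank_surj:
  fixes S :: "'a::linorder set"
  assumes "finite S" "c < card S"
  obtains x where "x \<in> S" "card {z \<in> S. z < x} = c"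
proof -
  let ?r = "\<lambda>x. card {z \<in> S. z < x}"
  have "inj_on ?r S"
    using rank_inj[OF assms(1)] by (auto intro: inj_onI)
  then have "card (?r ` S) = card S"
    by (rule card_image)
  moreover have "?r x < card S" if "x \<in> S" for x
    using assms(1) that by (intro psubset_card_mono) auto
  then have "?r ` S \<subseteq> {..<card S}"
    by blast
  ultimately have "?r ` S = {..<card S}"
    by (intro card_subset_eq) auto
  with assms(2) have "c \<in> ?r ` S"
    by simp
  with that show thesis
    by blast
qed

lemma lehmer_code_inj:
  assumes "distinct xs" "distinct ys" "set xs = set ys" "lehmer_code xs = lehmer_code ys"
  shows "xs = ys"
  using assms
proof (induction xs arbitrary: ys)
  case (Cons x xs)
  then obtain y ys' where ys: "ys = y # ys'" by (cases ys) auto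
  have "card {z \<in> set (x # xs). z < x} = card {z \<in> set (x # xs). z < y}"
    using Cons.prems ys length_filter_less_distinct[of x xs] length_filter_less_distinct[of y ys']
    by simp
  then have "x = y"
    by (rule rank_inj[rotated 3]) (use Cons.prems ys in auto)
  moreover have "xs = ys'"
    using Cons.prems ys \<open>x = y\<close> by (intro Cons.IH) (auto simp: insert_eq_iff)
  ultimately show ?case using ys by simp
qed auto

lemma lehmer_code_surj:
  assumes "finite S" "card S = length ps + z" "\<And>p. p \<in> set ps \<Longrightarrow> p \<le> z"
  shows "\<exists>xs. distinct xs \<and> set xs = S \<and> lehmer_code xs = ps @ replicate z 0"
  using assms
proof (induction ps arbitrary: S)
  case Nil
  have "lehmer_code (sorted_list_of_set S) = replicate z 0"
    using Nil by (simp add: lehmer_code_sorted)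
  then show ?case using Nil by (intro exI[of _ "sorted_list_of_set S"]) simp
next
  case (Cons p ps)
  have "p < card S" using Cons.prems(2) Cons.prems(3)[of p] by simp
  with Cons.prems(1) obtain x where x: "x \<in> S" "card {z \<in> S. z < x} = p"
    by (rule rank_surj)
  have "\<exists>xs. distinct xs \<and> set xs = S - {x} \<and> lehmer_code xs = ps @ replicate z 0"
    using Cons.prems x by (intro Cons.IH) auto
  then obtain xs where xs: "distinct xs" "set xs = S - {x}"
    "lehmer_code xs = ps @ replicate z 0" by blast
  have "distinct (x # xs)" "set (x # xs) = S" using xs x by auto
  moreover from this have "lehmer_code (x # xs) = (p # ps) @ replicate z 0"
    using length_filter_less_distinct[of x xs] xs x by simp
  ultimately show ?case by blast
qed

section \<open>Avoiding 132\<close>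

lemma contains_132_iff:
  "contains xs [1, 3, 2] \<longleftrightarrow>
     (\<exists>i j l. i < j \<and> j < l \<and> l < length xs \<and> xs ! i < xs ! l \<and> xs ! l < xs ! j)"
proof
  assume "contains xs [1, 3, 2]"
  then obtain f where f: "strict_mono_on {..<3::nat} f" "f ` {..<3} \<subseteq> {..<length xs}"
    "\<And>a b. a < 3 \<Longrightarrow> b < 3 \<Longrightarrow> xs ! f a < xs ! f b \<longleftrightarrow> [1, 3, 2::nat] ! a < [1, 3, 2] ! b"
    unfolding contains_def by (auto simp: numeral_3_eq_3)
  have "f 0 < f 1" "f 1 < f 2" "f 2 < length xs"
    using f(1,2) by (auto simp: strict_mono_on_def image_subset_iff)
  moreover have "xs ! f 0 < xs ! f 2" "xs ! f 2 < xs ! f 1"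
    using f(3)[of 0 2] f(3)[of 2 1] by auto
  ultimately show "\<exists>i j l. i < j \<and> j < l \<and> l < length xs \<and> xs ! i < xs ! l \<and> xs ! l < xs ! j"
    by blast
next
  assume "\<exists>i j l. i < j \<and> j < l \<and> l < length xs \<and> xs ! i < xs ! l \<and> xs ! l < xs ! j"
  then obtain i j l where *:
    "i < j" "j < l" "l < length xs" "xs ! i < xs ! l" "xs ! l < xs ! j" by blast
  have "strict_mono_on {..<3} (\<lambda>a. [i, j, l] ! a)"
    using * by (auto simp: strict_mono_on_def less_Suc_eq numeral_3_eq_3)
  moreover have "(\<lambda>a. [i, j, l] ! a) ` {..<3} \<subseteq> {..<length xs}"
    using * by (auto simp: less_Suc_eq numeral_3_eq_3)
  moreover have "\<forall>a<3. \<forall>b<3. xs ! ([i, j, l] ! a) < xs ! ([i, j, l] ! b)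
      \<longleftrightarrow> [1, 3, 2::nat] ! a < [1, 3, 2] ! b"
    using * by (auto simp: less_Suc_eq numeral_3_eq_3)
  ultimately show "contains xs [1, 3, 2]"
    unfolding contains_def by (intro exI[of _ "\<lambda>a. [i, j, l] ! a"]) (simp add: numeral_3_eq_3)
qed

lemma contains_132_Cons:
  "contains (x # xs) [1, 3, 2] \<longleftrightarrow>
     contains xs [1, 3, 2] \<or> (\<exists>j l. j < l \<and> l < length xs \<and> x < xs ! l \<and> xs ! l < xs ! j)"
  (is "?L \<longleftrightarrow> ?R")
proof
  assume ?L
  then obtain i j l where *: "i < j" "j < l" "l < length (x # xs)"
    "(x # xs) ! i < (x # xs) ! l" "(x # xs) ! l < (x # xs) ! j"
    unfolding contains_132_iff by blast
  obtain j' l' where jl: "j = Suc j'" "l = Suc l'"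
    using *(1,2) by (metis not_less0 old.nat.exhaust)
  show ?R
  proof (cases i)
    case 0
    with * jl show ?thesis by auto
  next
    case (Suc i')
    with * jl have "contains xs [1, 3, 2]"
      unfolding contains_132_iff by (intro exI[of _ i'] exI[of _ j'] exI[of _ l']) auto
    then show ?thesis ..
  qed
next
  assume ?R
  then show ?L
  proof
    assume "contains xs [1, 3, 2]"
    then obtain i j l where
      "i < j" "j < l" "l < length xs" "xs ! i < xs ! l" "xs ! l < xs ! j"
      unfolding contains_132_iff by blast
    then show ?L
      unfolding contains_132_iff
      by (intro exI[of _ "Suc i"] exI[of _ "Suc j"] exI[of _ "Suc l"]) simp
  next
    assume "\<exists>j l. j < l \<and> l < length xs \<and> x < xs ! l \<and> xs ! l < xs ! j"
    then obtain j l where "j < l" "l < length xs" "x < xs ! l" "xs ! l < xs ! j" by blast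
    then show ?L
      unfolding contains_132_iff
      by (intro exI[of _ 0] exI[of _ "Suc j"] exI[of _ "Suc l"]) simp
  qed
qed

text \<open>
  If a 132 starts at \<open>x\<close> but none starts later, then its largest letter may be taken
  to be the one right after \<open>x\<close>; so 132-avoidance is a condition on adjacent code entries.
\<close>

lemma avoids_132_Cons_Cons:
  assumes "distinct (x # y # ys)"
  shows "avoids (x # y # ys) [1, 3, 2] \<longleftrightarrow> avoids (y # ys) [1, 3, 2] \<and>
     length (filter (\<lambda>z. z < y) ys) \<le> length (filter (\<lambda>z. z < x) (y # ys))"
    (is "_ \<longleftrightarrow> _ \<and> ?cy \<le> ?cx")
proof -
  \<comment> \<open>The code entry of \<open>y\<close> exceeds that of \<open>x\<close> iff some letter of \<open>ys\<close> lies strictly between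
    \<open>x\<close> and \<open>y\<close> in value; the entries are compared as cardinalities.\<close>
  have cy: "?cy = card {z \<in> set ys. z < y}"
  proof -
    have "{z \<in> set (y # ys). z < y} = {z \<in> set ys. z < y}" by auto
    then show ?thesis
      using assms length_filter_less_distinct[of y ys] by (metis distinct.simps(2))
  qed
  have cx: "?cx = card {z \<in> insert y (set ys). z < x}"
  proof -
    have "{z \<in> set (x # y # ys). z < x} = {z \<in> insert y (set ys). z < x}" by auto
    then show ?thesis
      using assms length_filter_less_distinct[of x "y # ys"] by metis
  qed
  have "?cy \<le> ?cx \<longleftrightarrow> \<not> (\<exists>z \<in> set ys. x < z \<and> z < y)"
  proof
    assume le: "?cy \<le> ?cx"
    show "\<not> (\<exists>z \<in> set ys. x < z \<and> z < y)"
    proof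
      assume "\<exists>z \<in> set ys. x < z \<and> z < y"
      then obtain z where z: "z \<in> set ys" "x < z" "z < y" by blast
      then have "{z \<in> insert y (set ys). z < x} \<subseteq> {z \<in> set ys. z < y}"
        by auto
      moreover have "z \<in> {z \<in> set ys. z < y} - {z \<in> insert y (set ys). z < x}"
        using z by simp
      ultimately have "{z \<in> insert y (set ys). z < x} \<subset> {z \<in> set ys. z < y}"
        by blast
      then have "card {z \<in> insert y (set ys). z < x} < card {z \<in> set ys. z < y}"
        by (intro psubset_card_mono) auto
      with le show False unfolding cx cy by linarith
    qed
  next
    assume no: "\<not> (\<exists>z \<in> set ys. x < z \<and> z < y)"
    have "{z \<in> set ys. z < y} \<subseteq> {z \<in> insert y (set ys). z < x}"
    proof
      fix z assume "z \<in> {z \<in> set ys. z < y}"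
      moreover from this have "z \<noteq> x" "\<not> x < z" using no assms by auto
      ultimately show "z \<in> {z \<in> insert y (set ys). z < x}" by simp
    qed
    then have "card {z \<in> set ys. z < y} \<le> card {z \<in> insert y (set ys). z < x}"
      by (intro card_mono) auto
    then show "?cy \<le> ?cx" unfolding cx cy .
  qed
  moreover have "(\<exists>j l. j < l \<and> l < length (y # ys) \<and> x < (y # ys) ! l \<and>
      (y # ys) ! l < (y # ys) ! j) \<longleftrightarrow> (\<exists>z \<in> set ys. x < z \<and> z < y)" (is "?P \<longleftrightarrow> ?Q")
    if av: "avoids (y # ys) [1, 3, 2]"
  proof
    assume ?P
    then obtain j l where jl: "j < l" "l < length (y # ys)" "x < (y # ys) ! l"
      "(y # ys) ! l < (y # ys) ! j" by blast
    then obtain l' where l': "l = Suc l'" by (cases l) auto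
    have "ys ! l' < y"
    proof (rule ccontr)
      assume "\<not> ys ! l' < y"
      moreover have "ys ! l' \<noteq> y" using assms jl l' by auto
      ultimately have "y < ys ! l'" by simp
      moreover from this obtain j' where "j = Suc j'" using jl l' by (cases j) auto
      ultimately show False
        using av jl l' unfolding avoids_def contains_132_Cons by auto
    qed
    with jl l' show ?Q by (intro bexI[of _ "ys ! l'"]) auto
  next
    assume ?Q
    then obtain l where "l < length ys" "x < ys ! l" "ys ! l < y"
      by (metis in_set_conv_nth)
    then show ?P by (intro exI[of _ 0] exI[of _ "Suc l"]) simp
  qed
  ultimately show ?thesis
    using contains_132_Cons[of x "y # ys"] unfolding avoids_def by blast
qed

lemma avoids_132_iff:
  "distinct xs \<Longrightarrow> avoids xs [1, 3, 2] \<longleftrightarrow> sorted_wrt (\<ge>) (lehmer_code xs)"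
proof (induction xs rule: induct_list012)
  case (3 x y ys)
  show ?case
    using 3 avoids_132_Cons_Cons[of x y ys] by (auto intro: order.trans)
qed (auto simp: avoids_def contains_132_iff simp del: One_nat_def)

section \<open>Decreasing lists and multisets\<close>

lemma decreasing_eq_filter_append_zeros:
  fixes cs :: "nat list"
  assumes "sorted_wrt (\<ge>) cs"
  shows "cs = filter (\<lambda>c. c \<noteq> 0) cs @ replicate (length cs - length (filter (\<lambda>c. c \<noteq> 0) cs)) 0"
  using assms
proof (induction cs)
  case (Cons c cs)
  show ?case
  proof (cases "c = 0")
    case True
    with Cons.prems have "filter (\<lambda>c. c \<noteq> 0) cs = []" "cs = replicate (length cs) 0"
      by (auto simp: filter_empty_conv intro!: replicate_eqI)
    with True show ?thesis by simp
  next
    case False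
    with Cons show ?thesis by simp
  qed
qed simp

lemma decreasing_unique:
  fixes xs ys :: "'a::linorder list"
  assumes "sorted_wrt (\<ge>) xs" "sorted_wrt (\<ge>) ys" "mset xs = mset ys"
  shows "xs = ys"
proof -
  have "sorted (rev xs)" "sorted (rev ys)"
    using assms by (simp_all add: sorted_wrt_rev)
  then have "rev xs = rev ys"
    using assms(3) by (metis mset_rev properties_for_sort)
  then show ?thesis by simp
qed

section \<open>The bijection with partitions\<close>

text \<open>The partition of a permutation: the multiset of nonzero entries of its code.\<close>

definition code_partition :: "nat list \<Rightarrow> nat multiset" where
  "code_partition \<pi> = filter_mset (\<lambda>c. c \<noteq> 0) (mset (lehmer_code \<pi>))"

lemma sum_code_partition: "\<Sum>\<^sub># (code_partition \<pi>) = card (inversions \<pi>)"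
proof -
  have "\<Sum>\<^sub># (filter_mset (\<lambda>c. c \<noteq> 0) M) = \<Sum>\<^sub># M" for M :: "nat multiset"
    by (induction M) auto
  then show ?thesis
    by (simp add: code_partition_def sum_mset_sum_list sum_list_lehmer_code)
qed

text \<open>
  Trailing zeros by which one code extends another split off an increasing summand.
\<close>

lemma decomposable_if_longer:
  assumes "is_perm \<pi>" "is_perm \<sigma>" "\<pi> \<noteq> []" "length \<pi> < length \<sigma>"
    and "lehmer_code \<sigma> = lehmer_code \<pi> @ replicate (length \<sigma> - length \<pi>) 0"
  shows "decomposable \<sigma>"
proof -
  let ?\<iota> = "[1..<Suc (length \<sigma> - length \<pi>)]"
  have \<iota>: "is_perm ?\<iota>" "?\<iota> \<noteq> []"
    using assms(4) by (auto simp: is_perm_def)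
  have sum: "distinct (perm_sum \<pi> ?\<iota>)" "set (perm_sum \<pi> ?\<iota>) = {1..length \<sigma>}"
  proof -
    show "distinct (perm_sum \<pi> ?\<iota>)"
      using assms(1) by (auto simp: is_perm_def perm_sum_def distinct_map simp del: upt_Suc)
    have "(\<lambda>x. length \<pi> + x) ` {1..<Suc (length \<sigma> - length \<pi>)} = {length \<pi> + 1..length \<sigma>}"
      using assms(4) by (simp only: image_add_atLeastLessThan) auto
    then show "set (perm_sum \<pi> ?\<iota>) = {1..length \<sigma>}"
      using assms(1,4) by (auto simp: is_perm_def perm_sum_def simp del: upt_Suc)
  qed
  have "lehmer_code (perm_sum \<pi> ?\<iota>) = lehmer_code \<sigma>"
  proof -
    have "lehmer_code ?\<iota> = replicate (length ?\<iota>) 0"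
      by (rule lehmer_code_sorted) (rule sorted_upt)
    moreover have "length ?\<iota> = length \<sigma> - length \<pi>"
      by (simp del: upt_Suc)
    ultimately show ?thesis
      unfolding lehmer_code_perm_sum[OF assms(1) \<iota>(1)] assms(5) by presburger
  qed
  then have "\<sigma> = perm_sum \<pi> ?\<iota>"
    using assms(2) sum unfolding is_perm_def by (metis lehmer_code_inj)
  then show ?thesis
    using assms(1,3) \<iota> unfolding decomposable_def by blast
qed

lemma code_partition_inj: "inj_on code_partition (indec_avoiders k {[1, 3, 2]})"
proof -
  let ?nz = "\<lambda>\<pi>. filter (\<lambda>c. c \<noteq> 0) (lehmer_code \<pi>)"
  have eq: "\<pi> = \<sigma>"
    if \<pi>: "\<pi> \<in> indec_avoiders k {[1, 3, 2]}" and \<sigma>: "\<sigma> \<in> indec_avoiders k {[1, 3, 2]}"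
      and same: "code_partition \<pi> = code_partition \<sigma>" and le: "length \<pi> \<le> length \<sigma>" for \<pi> \<sigma>
  proof -
    have perm: "is_perm \<pi>" "is_perm \<sigma>" "\<pi> \<noteq> []" "\<not> decomposable \<sigma>"
      using \<pi> \<sigma> by (auto simp: indec_avoiders_def indecomposable_def)
    then have dec: "sorted_wrt (\<ge>) (lehmer_code \<pi>)" "sorted_wrt (\<ge>) (lehmer_code \<sigma>)"
      using \<pi> \<sigma> by (auto simp: indec_avoiders_def is_perm_def avoids_132_iff simp del: One_nat_def)
    have nz: "?nz \<pi> = ?nz \<sigma>"
      using dec same
      by (intro decreasing_unique sorted_wrt_filter) (simp_all add: code_partition_def)
    have "length (?nz \<pi>) \<le> length \<pi>"
      by (metis length_filter_le length_lehmer_code)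
    then have "replicate (length \<sigma> - length (?nz \<sigma>)) (0::nat) =
        replicate (length \<pi> - length (?nz \<pi>)) 0 @ replicate (length \<sigma> - length \<pi>) 0"
      using le nz by (simp flip: replicate_add)
    then have code: "lehmer_code \<sigma> = lehmer_code \<pi> @ replicate (length \<sigma> - length \<pi>) 0"
      using dec[THEN decreasing_eq_filter_append_zeros] nz
      by (metis append.assoc length_lehmer_code)
    have "length \<pi> = length \<sigma>"
      using decomposable_if_longer[OF perm(1,2,3) _ code] perm(4) le by linarith
    moreover from this have "lehmer_code \<pi> = lehmer_code \<sigma>"
      unfolding code by simp
    ultimately show "\<pi> = \<sigma>"
      using perm(1,2) unfolding is_perm_def by (metis lehmer_code_inj)
  qed
  show ?thesis
  proof (rule inj_onI)
    fix \<pi> \<sigma>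
    assume "\<pi> \<in> indec_avoiders k {[1, 3, 2]}" "\<sigma> \<in> indec_avoiders k {[1, 3, 2]}"
      "code_partition \<pi> = code_partition \<sigma>"
    then show "\<pi> = \<sigma>"
      using eq[of \<pi> \<sigma>] eq[of \<sigma> \<pi>] by (cases "length \<pi> \<le> length \<sigma>") auto
  qed
qed

text \<open>A decreasing list with positive entries is the nonzero part of the code of some
  indecomposable permutation, namely of the shortest non-empty one with such a code.\<close>

lemma indecomposable_with_code:
  assumes dec: "sorted_wrt (\<ge>) ps" and pos: "0 \<notin> set ps"
  obtains \<pi> z where "indecomposable \<pi>" "lehmer_code \<pi> = ps @ replicate z 0"
proof -
  let ?P = "\<lambda>\<pi>. is_perm \<pi> \<and> \<pi> \<noteq> [] \<and> (\<exists>z. lehmer_code \<pi> = ps @ replicate z 0)"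
  have "\<exists>\<pi>. ?P \<pi>"
  proof -
    \<comment> \<open>The sum bounds all parts; one more zero makes the permutation non-empty if \<open>ps = []\<close>.\<close>
    define z where "z = Suc (sum_list ps)"
    have "p \<le> z" if "p \<in> set ps" for p
      using member_le_sum_list[OF that] by (simp add: z_def)
    then obtain \<pi> where \<pi>: "distinct \<pi>" "set \<pi> = {1..length ps + z}"
      "lehmer_code \<pi> = ps @ replicate z 0"
      using lehmer_code_surj[of "{1..length ps + z}" ps z] by auto
    moreover have "length \<pi> = length ps + z"
      using \<pi>(3) by (metis length_append length_lehmer_code length_replicate)
    moreover from this have "\<pi> \<noteq> []" by (auto simp: z_def)
    ultimately have "?P \<pi>" unfolding is_perm_def by metis
    then show ?thesis ..
  qed
  then obtain \<pi> where \<pi>: "?P \<pi>" and min: "\<And>\<rho>. ?P \<rho> \<Longrightarrow> length \<pi> \<le> length \<rho>"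
    using ex_has_least_nat[of ?P _ length] by metis
  then obtain z where z: "lehmer_code \<pi> = ps @ replicate z 0" by blast
  have "\<not> decomposable \<pi>"
  proof
    assume "decomposable \<pi>"
    then obtain \<rho> \<tau> where \<rho>\<tau>: "is_perm \<rho>" "is_perm \<tau>" "\<rho> \<noteq> []" "\<tau> \<noteq> []" "\<pi> = perm_sum \<rho> \<tau>"
      unfolding decomposable_def by blast
    have split: "lehmer_code \<rho> @ lehmer_code \<tau> = ps @ replicate z 0"
      using \<rho>\<tau> z by (simp add: lehmer_code_perm_sum)
    have "length ps < length \<rho> \<or> lehmer_code \<rho> = take (length \<rho>) ps"
      using split by (metis append_eq_append_conv_if length_lehmer_code not_le)
    moreover have "lehmer_code \<rho> \<noteq> take (length \<rho>) ps"
    proof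
      assume "lehmer_code \<rho> = take (length \<rho>) ps"
      moreover have "last (lehmer_code \<rho>) \<in> set (lehmer_code \<rho>)"
        using \<rho>\<tau>(3) by (metis last_in_set length_0_conv length_lehmer_code)
      ultimately show False
        using last_lehmer_code[OF \<rho>\<tau>(3)] pos by (metis in_set_takeD)
    qed
    ultimately have "length ps < length \<rho>" by blast
    then have "lehmer_code \<rho> = ps @ take (length \<rho> - length ps) (replicate z 0)"
      using arg_cong[OF split, of "take (length \<rho>)"] by simp
    with \<rho>\<tau> have "?P \<rho>" by (auto simp: take_replicate)
    with min have "length \<pi> \<le> length \<rho>" by blast
    with \<rho>\<tau> show False by (simp add: perm_sum_def)
  qed
  with \<pi> z that show thesis by (auto simp: indecomposable_def)
qed

lemma bij_betw_code_partition:
  "bij_betw code_partition (indec_avoiders k {[1, 3, 2]}) (integer_partitions k)"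
proof -
  have "code_partition ` indec_avoiders k {[1, 3, 2]} \<subseteq> integer_partitions k"
    by (auto simp: indec_avoiders_def integer_partitions_def sum_code_partition)
      (simp add: code_partition_def)
  moreover have "M \<in> code_partition ` indec_avoiders k {[1, 3, 2]}"
    if M: "M \<in> integer_partitions k" for M
  proof -
    define ps where "ps = rev (sorted_list_of_multiset M)"
    have ps: "mset ps = M" "sorted_wrt (\<ge>) ps"
      by (simp_all add: ps_def sorted_wrt_rev)
    moreover have pos: "0 \<notin> set ps"
      using M ps(1) by (metis (mono_tags) integer_partitions_def mem_Collect_eq set_mset_mset)
    ultimately obtain \<pi> z where \<pi>: "indecomposable \<pi>" "lehmer_code \<pi> = ps @ replicate z 0"
      using indecomposable_with_code by blast
    have part: "code_partition \<pi> = M"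
    proof -
      have "filter_mset (\<lambda>c. c \<noteq> 0) (mset ps) = mset ps"
        using pos by (auto simp: filter_mset_eq_conv intro!: gr0I)
      then show ?thesis by (simp add: code_partition_def \<pi>(2) ps(1))
    qed
    have "sorted_wrt (\<ge>) (lehmer_code \<pi>)"
    proof -
      have "sorted_wrt (\<ge>) (replicate z (0::nat))"
        by (induction z) auto
      with ps(2) \<pi>(2) show ?thesis by (simp add: sorted_wrt_append)
    qed
    then have "avoids \<pi> [1, 3, 2]"
      using \<pi>(1) by (simp add: avoids_132_iff indecomposable_def is_perm_def del: One_nat_def)
    moreover have "card (inversions \<pi>) = k"
      using M part sum_code_partition[of \<pi>] by (simp add: integer_partitions_def)
    ultimately have "\<pi> \<in> indec_avoiders k {[1, 3, 2]}"
      using \<pi>(1) by (simp add: indec_avoiders_def)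
    with part show ?thesis by blast
  qed
  ultimately show ?thesis
    using code_partition_inj by (auto simp: bij_betw_def)
qed

theorem theorem3:
  fixes k :: nat
  shows "card (indec_avoiders k {[1, 3, 2]}) = card (integer_partitions k)"
  by (rule bij_betw_same_card[OF bij_betw_code_partition])

end
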